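(* Let $z\in\mathbb{C}$ and let $\alpha,\beta>0$ with $\alpha\beta=1$. Then \begin{align*} &\sqrt{\alpha}\,e^{\frac{z^2}{8}}\left(\operatorname{erf}\left(\frac{z}{2}\right)+4\int_{-\infty}^{0}\frac{e^{-\pi\alpha^2 x^2}\sin(\sqrt{\pi}\,\alpha xz)}{e^{2\pi x}-1}\, dx\right)\\ &=\sqrt{\beta}\,e^{-\frac{z^2}{8}}\left(\operatorname{erfi}\left(\frac{z}{2}\right)+4\int_{-\infty}^{0}\frac{e^{-\pi\beta^2 x^2}\sinh(\sqrt{\pi}\,\beta xz)}{e^{2\pi x}-1}\, dx\right). \end{align*}
   Context: $\operatorname{erf}(z)=\frac{2}{\sqrt{\pi}}\int_0^z e^{-t^2}\,dt$ and $\operatorname{erfi}(z)=\frac{2}{\sqrt{\pi}}\int_0^z e^{t^2}\,dt$. *)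

theory Defs
  imports "HOL-Complex_Analysis.Complex_Analysis"
begin

(* The integrands are entire, so integrating along the segment from 0 to z loses no generality. *)

definition erf :: "complex \<Rightarrow> complex" where
  "erf z = 2 / of_real (sqrt pi) * contour_integral (linepath 0 z) (\<lambda>t. exp (- (t ^ 2)))"

definition erfi :: "complex \<Rightarrow> complex" where
  "erfi z = 2 / of_real (sqrt pi) * contour_integral (linepath 0 z) (\<lambda>t. exp (t ^ 2))"

end

theory Submission
  imports Defs "HOL-Probability.Sinc_Integral"
begin

text \<open>
  Put \<open>p = sqrt pi * \<alpha>\<close> and \<open>q = sqrt pi * \<beta>\<close>, so that \<open>p * q = pi\<close>. Completing the square shows that
  \<open>exp (- (p x)^2) sin (p x z)\<close> is, up to a constant, the sine transform of \<open>exp (- (q y)^2) sinh (q y z)\<close>,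
  while the kernel \<open>1 / (exp (2 pi x) - 1)\<close> is almost its own sine transform: the transform is
  \<open>1 / (2 (exp (2 pi y) - 1)) + 1 / 4 - 1 / (4 pi y)\<close>, by the partial fractions of \<open>coth\<close>.
  By Fubini the integral against the kernel on the \<open>\<alpha>\<close> side turns into the one on the \<open>\<beta>\<close> side, and
  the terms \<open>1 / 4\<close> and \<open>1 / (4 pi y)\<close> contribute the multiples of \<open>erf\<close> and \<open>erfi\<close>.
\<close>

subsection \<open>Error functions\<close>

text \<open>An entire function has a global primitive, so the segment integral is a difference of
  two of its values. From here on both error functions are handled through their derivatives
  alone.\<close>

lemma has_field_derivative_contour_integral_linepath:
  assumes "f holomorphic_on UNIV"
  shows "((\<lambda>z. contour_integral (linepath a z) f) has_field_derivative f z) (at z)"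
proof -
  obtain g where g: "\<And>x. (g has_field_derivative f x) (at x)"
    using holomorphic_convex_primitive'[of UNIV f] assms by auto
  have "contour_integral (linepath a w) f = g w - g a" for w
    using contour_integral_primitive[of UNIV g f "linepath a w"] g
    by (auto intro!: contour_integral_unique)
  then show ?thesis
    by (auto intro!: derivative_eq_intros g)
qed

lemma has_field_derivative_erf:
  "(erf has_field_derivative 2 / of_real (sqrt pi) * exp (- (z ^ 2))) (at z)"
  unfolding erf_def[abs_def]
  by (intro DERIV_cmult has_field_derivative_contour_integral_linepath) (auto intro!: holomorphic_intros)

lemma has_field_derivative_erfi:
  "(erfi has_field_derivative 2 / of_real (sqrt pi) * exp (z ^ 2)) (at z)"
  unfolding erfi_def[abs_def]
  by (intro DERIV_cmult has_field_derivative_contour_integral_linepath) (auto intro!: holomorphic_intros)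

lemmas has_field_derivative_erf' [derivative_intros] = DERIV_chain2[OF has_field_derivative_erf]

lemmas has_field_derivative_erfi' [derivative_intros] = DERIV_chain2[OF has_field_derivative_erfi]

lemma erf_0 [simp]: "erf 0 = 0"
  by (simp add: erf_def)

lemma erfi_0 [simp]: "erfi 0 = 0"
  by (simp add: erfi_def)

text \<open>Serves to prove identities between error functions without moving contours: it suffices
  to compare derivatives and the value at 0.\<close>

lemma eq_if_same_derivative:
  fixes f g :: "complex \<Rightarrow> complex"
  assumes "\<And>z. (f has_field_derivative h z) (at z)" "\<And>z. (g has_field_derivative h z) (at z)" "f 0 = g 0"
  shows "f z = g z"
proof -
  have "((\<lambda>z. f z - g z) has_field_derivative 0) (at z within UNIV)" for z
    using DERIV_diff[OF assms(1,2)] by simp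
  from has_field_derivative_zero_constant[OF convex_UNIV this]
  obtain c where "\<And>z. f z - g z = c" by auto
  with assms(3) show ?thesis by (metis eq_iff_diff_eq_0)
qed

lemma erf_minus: "erf (- z) = - erf z"
  by (rule eq_if_same_derivative[where f = "\<lambda>z. erf (-z)" and g = "\<lambda>z. - erf z"])
    (auto intro!: derivative_eq_intros)

lemma erf_ii: "erf (\<i> * z) = \<i> * erfi z"
  by (rule eq_if_same_derivative[where f = "\<lambda>z. erf (\<i> * z)" and g = "\<lambda>z. \<i> * erfi z"])
    (auto intro!: derivative_eq_intros simp: power_mult_distrib)

text \<open>Mean value estimate on the disc of radius \<open>norm w\<close> about \<open>R\<close>.
  There the real part is at least \<open>R - norm w\<close> and the imaginary part at most
  \<open>norm w\<close> in size, so the derivative of \<open>erf\<close> decays like a Gaussian in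
  \<open>R\<close>. This carries a limit along the real axis over to every shifted line.\<close>

lemma erf_shift_tendsto_0: "((\<lambda>R. erf (of_real R + w) - erf (of_real R)) \<longlongrightarrow> 0) at_top"
proof (rule Lim_null_comparison)
  define B where "B = (\<lambda>R. 2 / sqrt pi * exp ((norm w)\<^sup>2 - (R - norm w)\<^sup>2) * norm w)"
  show "(B \<longlongrightarrow> 0) at_top"
    unfolding B_def by real_asymp
  show "eventually (\<lambda>R. norm (erf (of_real R + w) - erf (of_real R)) \<le> B R) at_top"
    using eventually_ge_at_top[of "norm w"]
  proof eventually_elim
    case (elim R)
    have "norm (erf (of_real R + w) - erf (of_real R))
        \<le> 2 / sqrt pi * exp ((norm w)\<^sup>2 - (R - norm w)\<^sup>2) * norm (of_real R + w - of_real R)"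
    proof (rule field_differentiable_bound)
      fix \<zeta> :: complex assume "\<zeta> \<in> cball (of_real R) (norm w)"
      then have \<zeta>: "norm (\<zeta> - of_real R) \<le> norm w"
        by (simp add: dist_norm norm_minus_commute)
      have "R - norm w \<le> Re \<zeta>"
        using abs_Re_le_cmod[of "\<zeta> - of_real R"] \<zeta> by simp
      then have "(R - norm w)\<^sup>2 \<le> (Re \<zeta>)\<^sup>2"
        using elim by (intro power_mono) auto
      moreover have "\<bar>Im \<zeta>\<bar> \<le> norm w"
        using abs_Im_le_cmod[of "\<zeta> - of_real R"] \<zeta> by simp
      then have "(Im \<zeta>)\<^sup>2 \<le> (norm w)\<^sup>2"
        by (metis abs_ge_zero power2_abs power_mono)
      ultimately show "norm (2 / of_real (sqrt pi) * exp (- (\<zeta> ^ 2)))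
          \<le> 2 / sqrt pi * exp ((norm w)\<^sup>2 - (R - norm w)\<^sup>2)"
        by (auto simp: norm_mult norm_divide Re_power2 intro!: mult_left_mono divide_right_mono)
      show "(erf has_field_derivative 2 / of_real (sqrt pi) * exp (- (\<zeta> ^ 2))) (at \<zeta> within cball (of_real R) (norm w))"
        by (rule has_field_derivative_at_within[OF has_field_derivative_erf])
    qed (auto simp: dist_norm)
    then show ?case by (simp add: B_def)
  qed
qed

subsection \<open>Gaussian integrals over the half-line\<close>

text \<open>Completing the square turns the integrand into a multiple of a normal density with mean
  \<open>c / (2 * p)\<close>; the deviation is fixed by 1 / (2 \<open>\<sigma>\<close>^2) =
  \<open>p\<close>^2.\<close>

lemma integrable_exp_gauss_real:
  assumes "p > 0"
  shows "integrable lborel (\<lambda>x::real. exp (p * x * c - (p * x)\<^sup>2))"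
proof -
  define \<sigma> where "\<sigma> = 1 / (sqrt 2 * p)"
  have \<sigma>: "2 * \<sigma>\<^sup>2 = 1 / p\<^sup>2" by (simp add: \<sigma>_def power_mult_distrib power_divide)
  have "exp (p * x * c - (p * x)\<^sup>2) = exp (c\<^sup>2 / 4) * sqrt (2 * pi * \<sigma>\<^sup>2) * normal_density (c / (2 * p)) \<sigma> x" for x
  proof -
    have "p * x * c - (p * x)\<^sup>2 = c\<^sup>2 / 4 + - (x - c / (2 * p))\<^sup>2 * p\<^sup>2"
      using assms by (simp add: field_simps power2_eq_square)
    moreover have "sqrt (2 * pi * \<sigma>\<^sup>2) \<noteq> 0"
      using assms by (simp add: \<sigma>_def)
    ultimately show ?thesis
      unfolding normal_density_def \<sigma> by (simp add: exp_add flip: exp_add)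
  qed
  moreover have "\<sigma> > 0" using assms by (simp add: \<sigma>_def)
  ultimately show ?thesis by simp
qed

lemma norm_exp_gauss:
  "norm (exp (of_real (p * x) * z - of_real ((p * x)\<^sup>2))) = exp (p * x * Re z - (p * x)\<^sup>2)"
  by simp

lemma integrable_exp_gauss:
  assumes "p > 0"
  shows "integrable lborel (\<lambda>x::real. exp (of_real (p * x) * z - of_real ((p * x)\<^sup>2)) :: complex)"
  by (rule Bochner_Integration.integrable_bound[OF integrable_exp_gauss_real[OF assms, of "Re z"]])
    (auto intro!: borel_measurable_continuous_onI continuous_intros simp: norm_exp_gauss)

text \<open>Completing the square gives a primitive in terms of \<open>erf\<close>. The behaviour of
  \<open>erf\<close> at infinity is left open here, because the case \<open>p = 1\<close>,
  \<open>z = 0\<close> of this very statement is what determines it.\<close>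

lemma tendsto_erf_gauss_integral:
  assumes "p > 0"
  shows "((\<lambda>R. exp (z\<^sup>2 / 4) * of_real (sqrt pi / (2 * p)) * (erf (of_real R - z / 2) + erf (z / 2)))
    \<longlongrightarrow> (LINT x:{0<..}|lborel. exp (of_real (p * x) * z - of_real ((p * x)\<^sup>2)))) at_top"
proof -
  define f where "f = (\<lambda>x::real. exp (of_real (p * x) * z - of_real ((p * x)\<^sup>2)) :: complex)"
  define F where "F = (\<lambda>x::real. exp (z\<^sup>2 / 4) * of_real (sqrt pi / (2 * p)) * erf (of_real (p * x) - z / 2))"
  have int: "integrable lborel (\<lambda>x. indicator {0..} x *\<^sub>R f x)"
    using integrable_exp_gauss[OF assms, of z]
    by (intro integrable_mult_indicator) (auto simp: f_def)
  have F: "(F has_vector_derivative f x) (at x within A)" for x A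
  proof -
    have "((\<lambda>x. exp (z\<^sup>2 / 4) * of_real (sqrt pi / (2 * p)) * erf (of_real p * x - z / 2))
        has_field_derivative f x) (at (of_real x))"
    proof -
      \<comment> \<open>The chain rule contributes three constants: the prefactor \<open>k\<close>,
        the factor \<open>m\<close> from the derivative of \<open>erf\<close>, and the inner
        derivative \<open>n\<close>. Their product is 1.\<close>
      have *: "a * b = a * k * (m * b * (n * 1 - 0))" if "k * m * n = 1" for a b k m n :: complex
        using that by algebra
      have "z\<^sup>2 / 4 + - (of_real p * of_real x - z / 2)\<^sup>2 = of_real (p * x) * z - of_real ((p * x)\<^sup>2)"
        by (simp add: field_simps power2_eq_square)
      then have "f x = exp (z\<^sup>2 / 4) * exp (- (of_real p * of_real x - z / 2)\<^sup>2)"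
        unfolding f_def exp_add[symmetric] by simp
      moreover have "complex_of_real (sqrt pi / (2 * p)) * (2 / of_real (sqrt pi)) * of_real p = 1"
        using assms by simp
      ultimately have "f x = exp (z\<^sup>2 / 4) * of_real (sqrt pi / (2 * p)) *
          (2 / of_real (sqrt pi) * exp (- (of_real p * of_real x - z / 2)\<^sup>2) * (of_real p * 1 - 0))"
        using * by metis
      then show ?thesis
        by (simp only:) (intro DERIV_cmult has_field_derivative_erf' derivative_intros)
    qed
    from has_vector_derivative_real_field[OF this] show ?thesis by (simp add: F_def)
  qed
  have eq: "(LINT x|lborel. indicator {..R} x *\<^sub>R (indicator {0..} x *\<^sub>R f x)) = F R - F 0" if "R \<ge> 0" for R
  proof -
    have "(LINT x|lborel. indicator {..R} x *\<^sub>R (indicator {0..} x *\<^sub>R f x))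
        = (LINT x|lborel. indicator {0..R} x *\<^sub>R f x)"
      by (intro Bochner_Integration.integral_cong) (auto simp: indicator_def)
    also have "\<dots> = F R - F 0"
      by (rule integral_FTC_atLeastAtMost[OF that F]) (auto simp: f_def intro!: continuous_intros)
    finally show ?thesis .
  qed
  have "((\<lambda>R. F R - F 0) \<longlongrightarrow> (LINT x|lborel. indicator {0..} x *\<^sub>R f x)) at_top"
    using tendsto_integral_at_top[OF _ int]
    by (rule Lim_transform_eventually) (auto intro!: eventually_mono[OF eventually_ge_at_top[of 0]] eq simp del: scaleR_scaleR)
  moreover have "(LINT x|lborel. indicator {0..} x *\<^sub>R f x) = (LINT x:{0<..}|lborel. f x)"
    unfolding set_lebesgue_integral_def[symmetric]
    by (rule set_integral_discrete_difference[of "{0}"]) auto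
  ultimately have "((\<lambda>R. F R - F 0) \<longlongrightarrow> (LINT x:{0<..}|lborel. f x)) at_top" by simp
  \<comment> \<open>Moving the upper endpoint from \<open>R\<close> to \<open>R / p\<close> removes
    \<open>p\<close> from the argument of \<open>erf\<close>.\<close>
  moreover have "filterlim (\<lambda>R. R / p) at_top at_top"
    using assms by real_asymp
  ultimately have "((\<lambda>R. F (R / p) - F 0) \<longlongrightarrow> (LINT x:{0<..}|lborel. f x)) at_top"
    by (rule filterlim_compose)
  then show ?thesis
    using assms by (simp add: F_def f_def erf_minus ring_distribs)
qed

text \<open>The limit along the real axis is calibrated by the known value sqrt pi / 2 of the
  half-line Gaussian integral; \<open>erf_shift_tendsto_0\<close> then handles the shift by
  \<open>w\<close>.\<close>

lemma tendsto_erf_at_top: "((\<lambda>R. erf (of_real R + w)) \<longlongrightarrow> 1) at_top"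
proof -
  have "(LINT x:{0<..}|lborel. exp (- x\<^sup>2)) = (LINT x:{0..}|lborel. exp (- x\<^sup>2 :: real))"
    by (rule set_integral_discrete_difference[of "{0}"]) auto
  also have "\<dots> = sqrt pi / 2"
    using gaussian_moment_0 by (simp add: has_bochner_integral_iff set_lebesgue_integral_def)
  finally have "(LINT x:{0<..}|lborel. exp (- x\<^sup>2)) = sqrt pi / 2" .
  moreover have "complex_of_real (exp (- x\<^sup>2)) = exp (- (of_real x)\<^sup>2)" for x
    by (metis exp_of_real of_real_minus of_real_power)
  moreover have "2 * complex_of_real (sqrt pi / 2) = of_real (sqrt pi)" by simp
  ultimately have "(LINT x:{0<..}|lborel. exp (of_real (1 * x) * 0 - of_real ((1 * x)\<^sup>2))) = complex_of_real (sqrt pi / 2)"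
    using set_integral_complex_of_real[of lborel "{0<..}" "\<lambda>x. exp (- x\<^sup>2)"] by (simp only: mult_1 mult_zero_right diff_0 of_real_power of_real_minus)
  from tendsto_mult_left[OF tendsto_erf_gauss_integral[of 1 0, unfolded this], of "2 / of_real (sqrt pi)"]
  have "((\<lambda>R. erf (of_real R)) \<longlongrightarrow> 1) at_top"
    by (simp add: field_simps)
  from tendsto_add[OF erf_shift_tendsto_0[of w] this] show ?thesis by simp
qed

lemma gauss_exp_integral:
  assumes "p > 0"
  shows "(LINT x:{0<..}|lborel. exp (of_real (p * x) * z - of_real ((p * x)\<^sup>2)))
       = exp (z\<^sup>2 / 4) * of_real (sqrt pi / (2 * p)) * (1 + erf (z / 2))"
proof (rule tendsto_unique[OF _ tendsto_erf_gauss_integral[OF assms]])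
  show "((\<lambda>R. exp (z\<^sup>2 / 4) * of_real (sqrt pi / (2 * p)) * (erf (of_real R - z / 2) + erf (z / 2)))
    \<longlongrightarrow> exp (z\<^sup>2 / 4) * of_real (sqrt pi / (2 * p)) * (1 + erf (z / 2))) at_top"
    using tendsto_erf_at_top[of "- z / 2"] by (intro tendsto_intros) simp
qed simp

lemma gauss_exp_integral_scaled:
  assumes "p > 0"
  shows "set_integrable lborel {0<..} (\<lambda>x. of_real (exp (- (p * x)\<^sup>2)) * exp (of_real (p * x) * z))"
    and "(LINT x:{0<..}|lborel. of_real (exp (- (p * x)\<^sup>2)) * exp (of_real (p * x) * z))
       = of_real (sqrt pi / (2 * p)) * exp (z\<^sup>2 / 4) * (1 + erf (z / 2))"
proof -
  have eq: "of_real (exp (- t)) * exp w = exp (w - of_real t)" for t and w :: complex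
    by (simp add: exp_diff exp_minus divide_inverse exp_of_real mult.commute)
  have "set_integrable lborel UNIV (\<lambda>x::real. exp (of_real (p * x) * z - of_real ((p * x)\<^sup>2)))"
    using integrable_exp_gauss[OF assms, of z] by (simp add: set_integrable_def)
  then show "set_integrable lborel {0<..} (\<lambda>x. of_real (exp (- (p * x)\<^sup>2)) * exp (of_real (p * x) * z))"
    unfolding eq by (rule set_integrable_subset) auto
  show "(LINT x:{0<..}|lborel. of_real (exp (- (p * x)\<^sup>2)) * exp (of_real (p * x) * z))
       = of_real (sqrt pi / (2 * p)) * exp (z\<^sup>2 / 4) * (1 + erf (z / 2))"
    unfolding eq gauss_exp_integral[OF assms] by (simp only: mult_ac)
qed

text \<open>Take half the difference and half the sum of the exponential integrals at
  \<open>z\<close> and \<open>- z\<close>. As \<open>erf\<close> is odd, the constant 1 cancels for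
  sinh and \<open>erf\<close> cancels for cosh. That the cosh integral is elementary is what later
  makes the sine transform explicit.\<close>

lemma
  assumes "p > 0"
  shows set_integrable_gauss_sinh:
      "set_integrable lborel {0<..} (\<lambda>x. of_real (exp (- (p * x)\<^sup>2)) * sinh (of_real (p * x) * z))"
    and gauss_sinh_integral:
      "(LINT x:{0<..}|lborel. of_real (exp (- (p * x)\<^sup>2)) * sinh (of_real (p * x) * z))
       = of_real (sqrt pi / (2 * p)) * exp (z\<^sup>2 / 4) * erf (z / 2)"
    and set_integrable_gauss_cosh:
      "set_integrable lborel {0<..} (\<lambda>x. of_real (exp (- (p * x)\<^sup>2)) * cosh (of_real (p * x) * z))"
    and gauss_cosh_integral:
      "(LINT x:{0<..}|lborel. of_real (exp (- (p * x)\<^sup>2)) * cosh (of_real (p * x) * z))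
       = of_real (sqrt pi / (2 * p)) * exp (z\<^sup>2 / 4)"
proof -
  define f where "f = (\<lambda>w (x::real). of_real (exp (- (p * x)\<^sup>2)) * exp (of_real (p * x) * w) :: complex)"
  have f: "set_integrable lborel {0<..} (f w)"
    "(LINT x:{0<..}|lborel. f w x) = of_real (sqrt pi / (2 * p)) * exp (w\<^sup>2 / 4) * (1 + erf (w / 2))" for w
    unfolding f_def using gauss_exp_integral_scaled[OF assms] by auto
  have sinh: "of_real (exp (- (p * x)\<^sup>2)) * sinh (of_real (p * x) * z) = (f z x - f (- z) x) / 2" for x
    by (simp add: f_def sinh_field_def right_diff_distrib)
  have cosh: "of_real (exp (- (p * x)\<^sup>2)) * cosh (of_real (p * x) * z) = (f z x + f (- z) x) / 2" for x
    by (simp add: f_def cosh_field_def ring_distribs)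
  show "set_integrable lborel {0<..} (\<lambda>x. of_real (exp (- (p * x)\<^sup>2)) * sinh (of_real (p * x) * z))"
    unfolding sinh using f(1) by auto
  show "set_integrable lborel {0<..} (\<lambda>x. of_real (exp (- (p * x)\<^sup>2)) * cosh (of_real (p * x) * z))"
    unfolding cosh using f(1) by auto
  show "(LINT x:{0<..}|lborel. of_real (exp (- (p * x)\<^sup>2)) * sinh (of_real (p * x) * z))
       = of_real (sqrt pi / (2 * p)) * exp (z\<^sup>2 / 4) * erf (z / 2)"
    unfolding sinh set_integral_divide_zero set_integral_diff(2)[OF f(1) f(1)] f(2)
    by (simp only: power2_minus minus_divide_left[symmetric] erf_minus) algebra
  show "(LINT x:{0<..}|lborel. of_real (exp (- (p * x)\<^sup>2)) * cosh (of_real (p * x) * z))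
       = of_real (sqrt pi / (2 * p)) * exp (z\<^sup>2 / 4)"
    unfolding cosh set_integral_divide_zero set_integral_add(2)[OF f(1) f(1)] f(2)
    by (simp only: power2_minus minus_divide_left[symmetric] erf_minus) algebra
qed

lemma sin_conv_sinh: "sin w = - \<i> * sinh (\<i> * w)" for w :: complex
  by (simp add: sin_exp_eq sinh_field_def field_simps)

text \<open>The sinh formulas at \<open>\<i> * z\<close>: the rotation flips the sign of
  \<open>z\<close>^2 and turns \<open>erf\<close> into \<open>erfi\<close>.\<close>

lemma
  assumes "p > 0"
  shows set_integrable_gauss_sin:
      "set_integrable lborel {0<..} (\<lambda>x. of_real (exp (- (p * x)\<^sup>2)) * sin (of_real (p * x) * z))"
    and gauss_sin_integral:
      "(LINT x:{0<..}|lborel. of_real (exp (- (p * x)\<^sup>2)) * sin (of_real (p * x) * z))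
       = of_real (sqrt pi / (2 * p)) * exp (- (z\<^sup>2 / 4)) * erfi (z / 2)"
proof -
  have eq: "of_real (exp (- (p * x)\<^sup>2)) * sin (of_real (p * x) * z)
      = - \<i> * (of_real (exp (- (p * x)\<^sup>2)) * sinh (of_real (p * x) * (\<i> * z)))" for x
    unfolding sin_conv_sinh by (simp only: mult_ac)
  show "set_integrable lborel {0<..} (\<lambda>x. of_real (exp (- (p * x)\<^sup>2)) * sin (of_real (p * x) * z))"
    unfolding eq using set_integrable_gauss_sinh[OF assms] by (intro set_integrable_mult_right)
  show "(LINT x:{0<..}|lborel. of_real (exp (- (p * x)\<^sup>2)) * sin (of_real (p * x) * z))
       = of_real (sqrt pi / (2 * p)) * exp (- (z\<^sup>2 / 4)) * erfi (z / 2)"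
    unfolding eq set_integral_mult_right gauss_sinh_integral[OF assms]
    using erf_ii[of "z / 2"] by (simp add: power_mult_distrib mult_ac)
qed

text \<open>Because \<open>p * q = pi\<close>, the angle 2 pi x y equals 2 (p x) (q y), so the sine
  is a sinh with parameter \<open>w\<close> = 2 i p x. A product of two sinh is half a difference of
  cosh at \<open>z + w\<close> and \<open>z - w\<close>, whose Gaussian integrals are elementary.
  Expanding the squares of \<open>z + w\<close> and \<open>z - w\<close> leaves the factor exp (- (p
  x)^2) and two conjugate phases that recombine to the sine.\<close>

lemma gauss_sinh_sin_integral:
  fixes z :: complex
  assumes "p > 0" "q > 0" "p * q = pi"
  shows "(LINT y:{0<..}|lborel. of_real (sin (2 * pi * x * y)) * (of_real (exp (- (q * y)\<^sup>2)) * sinh (of_real (q * y) * z)))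
    = of_real (sqrt pi / (2 * q)) * exp (z\<^sup>2 / 4) * (of_real (exp (- (p * x)\<^sup>2)) * sin (of_real (p * x) * z))"
proof -
  define w where "w = \<i> * of_real (2 * p * x)"
  have eq: "of_real (sin (2 * pi * x * y)) * (of_real (exp (- (q * y)\<^sup>2)) * sinh (of_real (q * y) * z))
      = - \<i> / 2 * (of_real (exp (- (q * y)\<^sup>2)) * cosh (of_real (q * y) * (z + w))
                 - of_real (exp (- (q * y)\<^sup>2)) * cosh (of_real (q * y) * (z - w)))" for y
  proof -
    have arg: "\<i> * of_real (2 * pi * x * y) = of_real (q * y) * w"
      unfolding w_def assms(3)[symmetric] by simp
    have "of_real (sin (2 * pi * x * y)) = - \<i> * sinh (of_real (q * y) * w)"
      using sin_conv_sinh[of "of_real (2 * pi * x * y)"] unfolding arg sin_of_real .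
    moreover have "2 * (sinh (a * w) * sinh (a * z)) = cosh (a * (z + w)) - cosh (a * (z - w))" for a :: complex
      by (simp add: distrib_left right_diff_distrib cosh_add cosh_diff)
    then have "sinh (a * w) * sinh (a * z) = (cosh (a * (z + w)) - cosh (a * (z - w))) / 2" for a :: complex
      by (simp add: eq_divide_eq mult.commute)
    moreover have "(- \<i> * b) * (c * d) = - \<i> / 2 * (c * e - c * f)" if "b * d = (e - f) / 2" for b c d e f :: complex
      using that by algebra
    ultimately show ?thesis by metis
  qed
  have sq: "(z + w)\<^sup>2 / 4 = z\<^sup>2 / 4 + of_real (- (p * x)\<^sup>2) + \<i> * (of_real (p * x) * z)"
    "(z - w)\<^sup>2 / 4 = z\<^sup>2 / 4 + of_real (- (p * x)\<^sup>2) + - (\<i> * (of_real (p * x) * z))"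
  proof -
    have "w\<^sup>2 = 4 * of_real (- (p * x)\<^sup>2)" "2 * (\<i> * (of_real (p * x) * z)) = z * w"
      by (simp_all add: w_def power_mult_distrib)
    then show "(z + w)\<^sup>2 / 4 = z\<^sup>2 / 4 + of_real (- (p * x)\<^sup>2) + \<i> * (of_real (p * x) * z)"
      "(z - w)\<^sup>2 / 4 = z\<^sup>2 / 4 + of_real (- (p * x)\<^sup>2) + - (\<i> * (of_real (p * x) * z))"
      by algebra+
  qed
  have "- \<i> / 2 * (exp ((z + w)\<^sup>2 / 4) - exp ((z - w)\<^sup>2 / 4))
      = exp (z\<^sup>2 / 4) * of_real (exp (- (p * x)\<^sup>2)) * sin (of_real (p * x) * z)"
    unfolding sq exp_add exp_of_real sin_exp_eq by (simp add: field_simps)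
  then show ?thesis
    unfolding eq set_integral_mult_right
      set_integral_diff(2)[OF set_integrable_gauss_cosh[OF assms(2)] set_integrable_gauss_cosh[OF assms(2)]]
      gauss_cosh_integral[OF assms(2)]
    by algebra
qed

text \<open>A product of two integrable one-variable functions is integrable on the plane, so each
  later exchange of integrals reduces to finding a majorant with separated variables.\<close>

lemma Fubini_dominated:
  fixes f :: "real \<Rightarrow> real \<Rightarrow> complex" and g h :: "real \<Rightarrow> real"
  assumes f [measurable]: "(\<lambda>(x, y). f x y) \<in> borel_measurable (lborel \<Otimes>\<^sub>M lborel)"
    and [measurable]: "A \<in> sets borel" "B \<in> sets borel"
    and g: "set_integrable lborel A g" and h: "set_integrable lborel B h"
    and le: "\<And>x y. x \<in> A \<Longrightarrow> y \<in> B \<Longrightarrow> norm (f x y) \<le> g x * h y"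
  shows "(LINT x:A|lborel. LINT y:B|lborel. f x y) = (LINT y:B|lborel. LINT x:A|lborel. f x y)"
proof -
  define F where "F = (\<lambda>x y. indicator A x *\<^sub>R indicator B y *\<^sub>R f x y)"
  define G H where "G = (\<lambda>x. indicator A x *\<^sub>R g x)" and "H = (\<lambda>y. indicator B y *\<^sub>R h y)"
  have GH: "integrable lborel G" "integrable lborel H"
    using g h by (simp_all add: set_integrable_def G_def H_def)
  then have [measurable]: "G \<in> borel_measurable borel" "H \<in> borel_measurable borel"
    by auto
  have "integrable (lborel \<Otimes>\<^sub>M lborel) (\<lambda>(x, y). G x * H y)"
  proof (rule lborel_pair.Fubini_integrable)
    show "integrable lborel (\<lambda>x. \<integral>y. norm (case (x, y) of (x, y) \<Rightarrow> G x * H y) \<partial>lborel)"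
      using GH by (simp add: abs_mult)
    show "AE x in lborel. integrable lborel (\<lambda>y. case (x, y) of (x, y) \<Rightarrow> G x * H y)"
      using GH by simp
  qed measurable
  then have "integrable (lborel \<Otimes>\<^sub>M lborel) (\<lambda>(x, y). F x y)"
  proof (rule Bochner_Integration.integrable_bound)
    show "AE xy in lborel \<Otimes>\<^sub>M lborel. norm (case xy of (x, y) \<Rightarrow> F x y) \<le> norm (case xy of (x, y) \<Rightarrow> G x * H y)"
      using le by (intro AE_I2) (auto simp: F_def G_def H_def indicator_def intro: order_trans[OF _ abs_ge_self])
  qed (use f in \<open>measurable, simp add: F_def\<close>)
  from lborel_pair.Fubini_integral[OF this]
  have "(\<integral>x. \<integral>y. F x y \<partial>lborel \<partial>lborel) = (\<integral>y. \<integral>x. F x y \<partial>lborel \<partial>lborel)" ..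
  moreover have "(\<integral>y. F x y \<partial>lborel) = indicator A x *\<^sub>R (\<integral>y. indicator B y *\<^sub>R f x y \<partial>lborel)" for x
    unfolding F_def by (simp only: integral_scaleR_right)
  moreover have "(\<integral>x. F x y \<partial>lborel) = indicator B y *\<^sub>R (\<integral>x. indicator A x *\<^sub>R f x y \<partial>lborel)" for y
  proof -
    have "F x y = indicator B y *\<^sub>R indicator A x *\<^sub>R f x y" for x
      by (simp add: F_def mult.commute)
    then show ?thesis by (simp only: integral_scaleR_right)
  qed
  ultimately show ?thesis
    unfolding set_lebesgue_integral_def by simp
qed

section \<open>Majorants for the Gaussian times sinh, with its zero at the origin\<close>

lemma norm_cosh_le: "norm (cosh w) \<le> exp (norm w)" for w :: complex
proof -
  have "norm (exp w + exp (- w)) \<le> exp (norm w) + exp (norm w)"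
    by (rule order_trans[OF norm_triangle_ineq add_mono])
      (use norm_exp[of w] norm_exp[of "- w"] in \<open>simp_all only: norm_minus_cancel\<close>)
  then show ?thesis by (simp add: cosh_field_def norm_divide)
qed

text \<open>Mean value bound from 0, with derivative cosh. The factor \<open>norm w\<close> records
  the zero of sinh at 0, which has to absorb the 1 / x singularity of the kernels.\<close>

lemma norm_sinh_le: "norm (sinh w) \<le> norm w * exp (norm w)" for w :: complex
proof -
  have "norm (sinh w - sinh 0) \<le> exp (norm w) * norm (w - 0)"
    by (intro field_differentiable_bound[of "cball 0 (norm w)" sinh cosh])
      (auto intro!: derivative_eq_intros order_trans[OF norm_cosh_le] simp: dist_norm)
  then show ?thesis by (simp add: mult.commute)
qed

lemma cmod_gauss_sinh_le:
  fixes z :: complex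
  assumes "p > 0" "x > 0"
  shows "norm (of_real (exp (- (p * x)\<^sup>2)) * sinh (of_real (p * x) * z))
    \<le> x * (p * norm z * exp (p * x * norm z - (p * x)\<^sup>2))"
proof -
  have "norm (of_real (exp (- (p * x)\<^sup>2)) * sinh (of_real (p * x) * z))
      = exp (- (p * x)\<^sup>2) * norm (sinh (of_real (p * x) * z))"
    by (simp add: norm_mult)
  also have "\<dots> \<le> exp (- (p * x)\<^sup>2) * (norm (of_real (p * x) * z) * exp (norm (of_real (p * x) * z)))"
    by (intro mult_left_mono norm_sinh_le) simp
  also have "\<dots> = x * (p * norm z * exp (p * x * norm z - (p * x)\<^sup>2))"
    using assms by (simp add: norm_mult abs_mult exp_diff exp_minus divide_inverse)
  finally show ?thesis .
qed

lemma borel_measurable_gauss_sinh [measurable]: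
  "(\<lambda>x::real. of_real (exp (- (p * x)\<^sup>2)) * sinh (of_real (p * x) * z) :: complex) \<in> borel_measurable borel"
  by (intro borel_measurable_continuous_onI continuous_intros)

lemma set_integrable_exp_gauss_real:
  "p > 0 \<Longrightarrow> set_integrable lborel {0<..} (\<lambda>x::real. exp (p * x * c - (p * x)\<^sup>2))"
  using integrable_exp_gauss_real[of p c] unfolding set_integrable_def
  by (intro integrable_mult_indicator) auto

text \<open>The hypothesis on \<open>k\<close> allows a singularity of order 1 / x at 0, cancelled
  by the factor \<open>x\<close> in \<open>cmod_gauss_sinh_le\<close>. It covers both 1 / x and the
  Bose kernel, and with \<open>\<i> * z\<close> for \<open>z\<close> it also covers the
  sine.\<close>

lemma set_integrable_gauss_sinh_times:
  fixes z :: complex and k :: "real \<Rightarrow> real"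
  assumes "p > 0" and [measurable]: "k \<in> borel_measurable borel"
    and k: "\<And>x. x > 0 \<Longrightarrow> \<bar>x * k x\<bar> \<le> 1"
  shows "set_integrable lborel {0<..} (\<lambda>x. of_real (k x) * (of_real (exp (- (p * x)\<^sup>2)) * sinh (of_real (p * x) * z)))"
proof (rule set_integrable_bound)
  show "set_integrable lborel {0<..} (\<lambda>x. p * norm z * exp (p * x * norm z - (p * x)\<^sup>2))"
    using set_integrable_exp_gauss_real[OF assms(1)] by (intro set_integrable_mult_right)
  show "AE x in lborel. x \<in> {0<..} \<longrightarrow>
      norm (of_real (k x) * (of_real (exp (- (p * x)\<^sup>2)) * sinh (of_real (p * x) * z)))
      \<le> norm (p * norm z * exp (p * x * norm z - (p * x)\<^sup>2))"
  proof (intro AE_I2 impI)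
    fix x :: real assume "x \<in> {0<..}"
    then have x: "x > 0" by simp
    have "norm (of_real (k x) * (of_real (exp (- (p * x)\<^sup>2)) * sinh (of_real (p * x) * z)))
        \<le> \<bar>k x\<bar> * (x * (p * norm z * exp (p * x * norm z - (p * x)\<^sup>2)))"
      using mult_left_mono[OF cmod_gauss_sinh_le[OF assms(1) x, of z], of "\<bar>k x\<bar>"]
      by (simp only: norm_mult norm_of_real abs_ge_zero)
    also have "\<dots> = \<bar>x * k x\<bar> * (p * norm z * exp (p * x * norm z - (p * x)\<^sup>2))"
      using x by (simp add: abs_mult)
    also have "\<dots> \<le> 1 * (p * norm z * exp (p * x * norm z - (p * x)\<^sup>2))"
      using assms(1) by (intro mult_right_mono k x) simp
    finally show "norm (of_real (k x) * (of_real (exp (- (p * x)\<^sup>2)) * sinh (of_real (p * x) * z)))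
      \<le> norm (p * norm z * exp (p * x * norm z - (p * x)\<^sup>2))"
      using assms(1) by simp
  qed
qed (unfold set_borel_measurable_def, measurable)

text \<open>Write sinh (p x z) / x as the integral over t from 0 to 1 of p z cosh (p x t z) and
  exchange the integrals. The cosh integral yields a multiple of exp ((t z / 2)^2), which integrates
  in t to \<open>erfi\<close>; the parameter \<open>p\<close> drops out.\<close>

lemma gauss_sinh_over_integral:
  fixes z :: complex
  assumes "p > 0"
  shows "(LINT x:{0<..}|lborel. of_real (1 / x) * (of_real (exp (- (p * x)\<^sup>2)) * sinh (of_real (p * x) * z)))
    = of_real (pi / 2) * erfi (z / 2)"
proof -
  define f where "f = (\<lambda>x t::real. of_real p * z * (of_real (exp (- (p * x)\<^sup>2)) * cosh (of_real (p * x) * (of_real t * z))))"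
  have "(LINT x:{0<..}|lborel. LINT t:{0..1}|lborel. f x t) = (LINT t:{0..1}|lborel. LINT x:{0<..}|lborel. f x t)"
  proof (rule Fubini_dominated)
    have "continuous_on UNIV (\<lambda>xt. f (fst xt) (snd xt))"
      unfolding f_def by (intro continuous_intros)
    then show "(\<lambda>(x, t). f x t) \<in> borel_measurable (lborel \<Otimes>\<^sub>M lborel)"
      by (simp add: lborel_prod borel_measurable_continuous_onI case_prod_beta')
    show "set_integrable lborel {0<..} (\<lambda>x. p * norm z * exp (p * x * norm z - (p * x)\<^sup>2))"
      using set_integrable_exp_gauss_real[OF assms] by (intro set_integrable_mult_right)
    show "set_integrable lborel {0..1} (\<lambda>t::real. 1 :: real)"
      by (simp add: set_integrable_def)
    fix x t :: real assume "x \<in> {0<..}" "t \<in> {0..1}"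
    then have xt: "x > 0" "0 \<le> t" "t \<le> 1" by auto
    have "norm (of_real (p * x) * (of_real t * z)) \<le> p * x * norm z"
      using xt assms by (auto simp: norm_mult abs_mult intro!: mult_left_mono mult_left_le_one_le)
    then have "norm (cosh (of_real (p * x) * (of_real t * z))) \<le> exp (p * x * norm z)"
      by (intro order_trans[OF norm_cosh_le]) simp
    then have "p * norm z * (exp (- (p * x)\<^sup>2) * norm (cosh (of_real (p * x) * (of_real t * z))))
        \<le> p * norm z * (exp (- (p * x)\<^sup>2) * exp (p * x * norm z))"
      using assms by (intro mult_left_mono) auto
    also have "\<dots> = p * norm z * exp (p * x * norm z - (p * x)\<^sup>2) * 1"
      by (simp add: exp_diff exp_minus divide_inverse)
    finally show "norm (f x t) \<le> p * norm z * exp (p * x * norm z - (p * x)\<^sup>2) * 1"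
      using assms by (simp add: f_def norm_mult mult_ac)
  qed auto
  also have "(LINT x:{0<..}|lborel. LINT t:{0..1}|lborel. f x t)
      = (LINT x:{0<..}|lborel. of_real (1 / x) * (of_real (exp (- (p * x)\<^sup>2)) * sinh (of_real (p * x) * z)))"
  proof (rule set_lebesgue_integral_cong)
    show "\<forall>x. x \<in> {0<..} \<longrightarrow> (LINT t:{0..1}|lborel. f x t)
        = of_real (1 / x) * (of_real (exp (- (p * x)\<^sup>2)) * sinh (of_real (p * x) * z))"
    proof (intro allI impI)
      fix x :: real assume "x \<in> {0<..}"
      then have x: "x > 0" by simp
      define F where "F = (\<lambda>t. of_real (1 / x) * (of_real (exp (- (p * x)\<^sup>2)) * sinh (of_real (p * x) * (t * z))))"
      have "(LINT t:{0..1}|lborel. f x t) = F (of_real 1) - F (of_real 0)"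
        unfolding set_lebesgue_integral_def
      proof (rule integral_FTC_atLeastAtMost)
        show "((\<lambda>t. F (of_real t)) has_vector_derivative f x t) (at t within {0..1})" for t
        proof (rule has_vector_derivative_real_field)
          show "(F has_field_derivative f x t) (at (of_real t))"
            using x by (auto simp: F_def f_def intro!: derivative_eq_intros)
        qed
      qed (auto simp: f_def intro!: continuous_intros)
      then show "(LINT t:{0..1}|lborel. f x t)
        = of_real (1 / x) * (of_real (exp (- (p * x)\<^sup>2)) * sinh (of_real (p * x) * z))"
        by (simp add: F_def)
    qed
  qed auto
  also have "(LINT t:{0..1}|lborel. LINT x:{0<..}|lborel. f x t)
      = (LINT t:{0..1}|lborel. of_real (sqrt pi / 2) * z * exp ((of_real t * z / 2)\<^sup>2))"
    unfolding f_def set_integral_mult_right gauss_cosh_integral[OF assms]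
    using assms by (simp add: power_divide)
  also have "(LINT t:{0..1}|lborel. of_real (sqrt pi / 2) * z * exp ((of_real t * z / 2)\<^sup>2))
      = of_real (pi / 2) * erfi (of_real 1 * z / 2) - of_real (pi / 2) * erfi (of_real 0 * z / 2)"
    unfolding set_lebesgue_integral_def
  proof (rule integral_FTC_atLeastAtMost)
    fix t :: real
    have "complex_of_real (sqrt pi) * of_real (sqrt pi) = of_real pi"
      by (simp flip: of_real_mult)
    then have pi: "of_real (pi / 2) * (2 / of_real (sqrt pi) * e * (z / 2)) = of_real (sqrt pi / 2) * z * e" for e
      by (simp add: field_simps)
    show "((\<lambda>t. of_real (pi / 2) * erfi (of_real t * z / 2)) has_vector_derivative
        of_real (sqrt pi / 2) * z * exp ((of_real t * z / 2)\<^sup>2)) (at t within {0..1})"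
    proof (rule has_vector_derivative_real_field)
      show "((\<lambda>t. of_real (pi / 2) * erfi (t * z / 2)) has_field_derivative
        of_real (sqrt pi / 2) * z * exp ((of_real t * z / 2)\<^sup>2)) (at (of_real t))"
        unfolding pi[symmetric]
        by (intro DERIV_cmult has_field_derivative_erfi') (auto intro!: derivative_eq_intros)
    qed
  qed (auto intro!: continuous_intros)
  finally show ?thesis by simp
qed

subsection \<open>The sine transform of the Bose kernel\<close>

text \<open>The right-hand side is (pi / 2) coth (pi y) - 1 / (2 y). With \<open>z\<close> = i y,
  subtracting the Digamma series at \<open>1 + z\<close> from that at \<open>1 - z\<close> produces
  the sum, and the reflection formula evaluates the difference.\<close>

lemma coth_partial_fractions:
  fixes y :: real
  assumes "y > 0"
  shows "(\<lambda>n. y / ((real (Suc n))\<^sup>2 + y\<^sup>2)) sums (pi / 2 + pi / (exp (2 * pi * y) - 1) - 1 / (2 * y))"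
proof -
  define z where "z = \<i> * complex_of_real y"
  have nz: "z \<noteq> 0" "1 + z \<noteq> 0" "1 - z \<noteq> 0" and nonint: "z \<notin> \<int>\<^sub>\<le>\<^sub>0" "1 - z \<notin> \<int>\<^sub>\<le>\<^sub>0"
    using assms by (auto simp: z_def complex_eq_iff elim!: nonpos_Ints_cases)
  have Digamma_sums: "(\<lambda>n. inverse (of_nat (Suc n)) - inverse (w + of_nat n)) sums (Digamma w + euler_mascheroni)"
    if "w \<noteq> 0" for w :: complex
    using summable_Digamma[OF that] by (simp add: Digamma_def summable_sums)
  have "(\<lambda>n. inverse (1 + z + of_nat n) - inverse (1 - z + of_nat n)) sums (Digamma (1 - z) - Digamma (1 + z))"
    using sums_diff[OF Digamma_sums[OF nz(3)] Digamma_sums[OF nz(2)]] by simp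
  moreover have "inverse (1 + z + of_nat n) - inverse (1 - z + of_nat n)
      = -2 * \<i> * of_real (y / ((real (Suc n))\<^sup>2 + y\<^sup>2))" for n
  proof -
    have "(1 + z + of_nat n) * (1 - z + of_nat n) = of_real ((real (Suc n))\<^sup>2 + y\<^sup>2)"
      by (simp add: z_def algebra_simps power2_eq_square)
    moreover have "1 + z + of_nat n \<noteq> 0" "1 - z + of_nat n \<noteq> 0"
      using assms by (auto simp: z_def complex_eq_iff)
    then have "inverse (1 + z + of_nat n) - inverse (1 - z + of_nat n)
        = - 2 * z / ((1 + z + of_nat n) * (1 - z + of_nat n))"
      by (simp add: field_simps)
    ultimately show ?thesis by (simp add: z_def)
  qed
  ultimately have sums: "(\<lambda>n. -2 * \<i> * of_real (y / ((real (Suc n))\<^sup>2 + y\<^sup>2))) sums (Digamma (1 - z) - Digamma (1 + z))"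
    by simp
  \<comment> \<open>Differentiating sin (pi w) / pi both directly and as a product of reciprocal
    Gamma functions gives Digamma (1 - z) - Digamma z = pi cot (pi z), stated below without
    division.\<close>
  have "((\<lambda>w. rGamma w * rGamma (1 - w)) has_field_derivative
      rGamma z * rGamma (1 - z) * (Digamma (1 - z) - Digamma z)) (at z)"
    using nonint by (auto intro!: derivative_eq_intros simp: algebra_simps)
  moreover have "((\<lambda>w. rGamma w * rGamma (1 - w)) has_field_derivative cos (of_real pi * z)) (at z)"
    unfolding rGamma_reflection_complex by (auto intro!: derivative_eq_intros)
  ultimately have "rGamma z * rGamma (1 - z) * (Digamma (1 - z) - Digamma z) = cos (of_real pi * z)"
    by (rule DERIV_unique)
  then have *: "sin (of_real pi * z) * (Digamma (1 - z) - Digamma z) = of_real pi * cos (of_real pi * z)"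
    by (simp add: rGamma_reflection_complex field_simps)
  define E where "E = exp (2 * pi * y)"
  have E: "E > 1" using assms by (simp add: E_def)
  define e where "e = exp (pi * y)"
  have e: "e > 1" "E = e * e" using assms by (simp_all add: e_def E_def flip: exp_add)
  have arg: "of_real pi * z = \<i> * of_real (pi * y)" by (simp add: z_def)
  have ii: "\<i> * (\<i> * of_real t) = of_real (- t)" for t
    by (simp add: complex_eq_iff)
  have exps: "exp (\<i> * (\<i> * of_real (pi * y))) = of_real (1 / e)" "exp (- (\<i> * (\<i> * of_real (pi * y)))) = of_real e"
    unfolding ii of_real_minus[symmetric] exp_of_real e_def by (simp_all add: exp_minus inverse_eq_divide)
  \<comment> \<open>These are sinh (pi y) and cosh (pi y). Since \<open>z\<close> is imaginary, the
    cotangent becomes - i \<open>C\<close> / \<open>S\<close>, and coth is rewritten as 1 + 2 /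
    (\<open>E\<close> - 1) to expose the kernel.\<close>
  define S C where "S = (e - 1 / e) / 2" and "C = (e + 1 / e) / 2"
  have S: "S \<noteq> 0" and CS: "C = S * (1 + 2 / (E - 1))"
  proof -
    have nz: "E - 1 \<noteq> 0" "e \<noteq> 0" using e E by auto
    have "(e - 1 / e) / 2 = (e * e - 1) / (2 * e)" "(e + 1 / e) / 2 = (e * e + 1) / (2 * e)"
      using nz(2) by (simp_all add: field_simps)
    then have "S = (E - 1) / (2 * e)" "C = (E + 1) / (2 * e)"
      by (simp_all only: S_def C_def e(2))
    moreover have "1 + 2 / (E - 1) = (E + 1) / (E - 1)"
      using nz(1) by (simp add: field_simps)
    moreover note nz
    ultimately show "C = S * (1 + 2 / (E - 1))" "S \<noteq> 0"
      by simp_all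
  qed
  have "1 / e - e = - 2 * S"
    by (simp add: S_def)
  then have diff: "complex_of_real (1 / e) - of_real e = of_real (- 2 * S)"
    by (simp only: flip: of_real_diff)
  have "x / (2 * \<i>) = - \<i> * (x / 2)" for x
    by (simp add: field_simps)
  then have sin: "sin (of_real pi * z) = \<i> * of_real S"
    unfolding arg sin_exp_eq exps diff by simp
  have cos: "cos (of_real pi * z) = of_real C"
    unfolding arg cos_exp_eq exps C_def by (simp add: add.commute)
  have "(Digamma (1 - z) - Digamma z) * \<i> * of_real S = of_real (pi * (1 + 2 / (E - 1))) * of_real S"
    using * unfolding sin cos CS by (simp only: of_real_mult mult_ac)
  then have "(Digamma (1 - z) - Digamma z) * \<i> = of_real (pi * (1 + 2 / (E - 1)))"
    using S by (simp only: mult_cancel_right of_real_eq_0_iff simp_thms)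
  moreover have "D = - \<i> * (D * \<i>)" for D
    by (simp add: complex_eq_iff)
  ultimately have "Digamma (1 - z) - Digamma z = - \<i> * of_real (pi * (1 + 2 / (E - 1)))"
    by metis
  \<comment> \<open>The series involves \<open>1 + z\<close> while reflection involves
    \<open>z\<close>; this recurrence bridges the two and is the source of the term 1 / (2
    y).\<close>
  moreover have "Digamma (1 + z) = Digamma z + 1 / z"
    using Digamma_plus1[OF nz(1)] by (simp add: add.commute)
  moreover have "1 / z = - \<i> * of_real (1 / y)"
    using assms by (simp add: z_def field_simps)
  ultimately have "Digamma (1 - z) - Digamma (1 + z) = - \<i> * of_real (pi * (1 + 2 / (E - 1))) + \<i> * of_real (1 / y)"
    by simp
  also have "\<dots> = -2 * \<i> * of_real (pi / 2 + pi / (E - 1) - 1 / (2 * y))"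
    by (simp add: complex_eq_iff ring_distribs)
  finally have "Digamma (1 - z) - Digamma (1 + z) = \<dots>" .
  from sums_mult[OF sums[unfolded this], of "\<i> / 2"]
  have "(\<lambda>n. complex_of_real (y / ((real (Suc n))\<^sup>2 + y\<^sup>2))) sums of_real (pi / 2 + pi / (E - 1) - 1 / (2 * y))"
    by (simp only: mult.assoc[symmetric]) simp
  then show ?thesis unfolding sums_of_real_iff E_def .
qed

section \<open>Laplace integrals for the terms of the kernel's series\<close>

lemma exp_integral_0_infinity:
  fixes c :: complex
  assumes "Re c > 0"
  shows "set_integrable lborel {0<..} (\<lambda>x. exp (- (c * of_real x)))"
    and "(LINT x:{0<..}|lborel. exp (- (c * of_real x))) = 1 / c"
proof -
  define f where "f = (\<lambda>x::real. exp (- (c * of_real x)))"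
  have [measurable]: "f \<in> borel_measurable borel"
    by (auto simp: f_def intro!: borel_measurable_continuous_onI continuous_intros)
  show int: "set_integrable lborel {0<..} f"
    using integrable_I0i_exp_mscale[OF assms]
    by (rule set_integrable_bound) (auto simp: f_def set_borel_measurable_def)
  have eq: "(LINT x|lborel. indicator {..R} x *\<^sub>R (indicator {0<..} x *\<^sub>R f x)) = 1 / c - exp (- (c * of_real R)) / c"
    if "R \<ge> 0" for R
  proof -
    have "(LINT x|lborel. indicator {..R} x *\<^sub>R (indicator {0<..} x *\<^sub>R f x)) = (LINT x:{0<..R}|lborel. f x)"
      unfolding set_lebesgue_integral_def by (intro Bochner_Integration.integral_cong) (auto simp: indicator_def)
    also have "\<dots> = (LINT x:{0..R}|lborel. f x)"
      by (rule set_integral_discrete_difference[of "{0}"]) auto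
    also have "\<dots> = - exp (- (c * of_real R)) / c - - exp (- (c * of_real 0)) / c"
      unfolding set_lebesgue_integral_def
    proof (rule integral_FTC_atLeastAtMost[OF that])
      show "((\<lambda>x. - exp (- (c * complex_of_real x)) / c) has_vector_derivative f x) (at x within {0..R})" for x
      proof (rule has_vector_derivative_real_field)
        show "((\<lambda>x. - exp (- (c * x)) / c) has_field_derivative f x) (at (of_real x))"
          using assms by (auto intro!: derivative_eq_intros simp: f_def)
      qed
    qed (auto simp: f_def intro!: continuous_intros)
    finally show ?thesis by simp
  qed
  have "((\<lambda>R. exp (- (c * of_real R))) \<longlongrightarrow> 0) at_top"
  proof (rule tendsto_norm_zero_cancel)
    show "((\<lambda>R. norm (exp (- (c * of_real R)))) \<longlongrightarrow> 0) at_top"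
      using assms by simp real_asymp
  qed
  then have "((\<lambda>R. 1 / c - exp (- (c * of_real R)) / c) \<longlongrightarrow> 1 / c) at_top"
    using tendsto_diff[OF tendsto_const tendsto_divide[OF _ tendsto_const], of _ 0 at_top c "1 / c"] assms
    by (metis complex_Re_numeral div_0 diff_zero less_irrefl zero_complex.sel(1))
  moreover have "((\<lambda>R. 1 / c - exp (- (c * of_real R)) / c) \<longlongrightarrow> (LINT x:{0<..}|lborel. f x)) at_top"
    unfolding set_lebesgue_integral_def
    using tendsto_integral_at_top[OF _ int[unfolded set_integrable_def]]
    by (rule Lim_transform_eventually) (auto intro!: eventually_mono[OF eventually_ge_at_top[of 0]] eq simp del: scaleR_scaleR)
  ultimately show "(LINT x:{0<..}|lborel. f x) = 1 / c"
    using tendsto_unique by (metis trivial_limit_at_top_linorder)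
qed

text \<open>Imaginary part of the exponential integral with \<open>c\<close> = a - i b, whose value
  is 1 / \<open>c\<close>.\<close>

lemma exp_sin_integral_0_infinity:
  fixes a b :: real
  assumes "a > 0"
  shows "set_integrable lborel {0<..} (\<lambda>x. exp (- (a * x)) * sin (b * x))"
    and "(LINT x:{0<..}|lborel. exp (- (a * x)) * sin (b * x)) = b / (a\<^sup>2 + b\<^sup>2)"
proof -
  define c where "c = Complex a (- b)"
  have c: "Re c > 0" using assms by (simp add: c_def)
  have Im: "Im (exp (- (c * of_real x))) = exp (- (a * x)) * sin (b * x)" for x
    by (simp add: Im_exp c_def)
  note int = exp_integral_0_infinity[OF c, unfolded set_integrable_def set_lebesgue_integral_def]
  show "set_integrable lborel {0<..} (\<lambda>x. exp (- (a * x)) * sin (b * x))"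
    using integrable_Im[OF int(1)] by (simp add: Im set_integrable_def)
  have "(LINT x:{0<..}|lborel. exp (- (a * x)) * sin (b * x)) = Im (1 / c)"
    using integral_Im[OF int(1)] unfolding int(2) by (simp add: Im set_lebesgue_integral_def)
  then show "(LINT x:{0<..}|lborel. exp (- (a * x)) * sin (b * x)) = b / (a\<^sup>2 + b\<^sup>2)"
    by (simp add: c_def Im_divide)
qed

text \<open>A rescaled Gamma integral. Its quadratic decay in \<open>a\<close> supplies the summable
  bound in \<open>sine_transform_bose\<close>.\<close>

lemma times_exp_integral_0_infinity:
  fixes a :: real
  assumes "a > 0"
  shows "has_bochner_integral lborel (\<lambda>x. indicator {0<..} x *\<^sub>R (x * exp (- (a * x)))) (1 / a\<^sup>2)"
proof -
  have "has_bochner_integral lborel (\<lambda>x. indicator {0<..} (0 + a * x) *\<^sub>R ((0 + a * x) * exp (- (0 + a * x)))) (1 /\<^sub>R \<bar>a\<bar>)"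
    using has_bochner_integral_I0i_power_exp_m[of 1] assms
    by (intro lborel_has_bochner_integral_real_affine_iff[THEN iffD1]) (simp_all add: mult_ac)
  from has_bochner_integral_mult_right[OF this, of "1 / a"]
  show ?thesis
    using assms by (simp add: indicator_def zero_less_mult_iff power2_eq_square field_simps)
qed

text \<open>Expand the kernel as a geometric series in exp (- 2 pi x), integrate each damped sine,
  and resum with \<open>coth_partial_fractions\<close>. The index \<open>Suc n\<close> appears
  because the series starts at the first power.\<close>

lemma sine_transform_bose:
  fixes y :: real
  assumes "y > 0"
  shows "(LINT x:{0<..}|lborel. sin (2 * pi * x * y) / (exp (2 * pi * x) - 1))
    = 1 / (2 * (exp (2 * pi * y) - 1)) + 1 / 4 - 1 / (4 * pi * y)"
proof -
  define f where "f = (\<lambda>n x. indicator {0<..} x *\<^sub>R (exp (- (2 * pi * real (Suc n) * x)) * sin (2 * pi * y * x)))"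
  have geo: "(\<lambda>n. exp (- (2 * pi * real (Suc n) * x))) sums (1 / (exp (2 * pi * x) - 1))" if "x > 0" for x
  proof -
    define r where "r = exp (- (2 * pi * x))"
    have r: "norm r < 1" "r > 0" using that by (auto simp: r_def)
    have "exp (- (2 * pi * real (Suc n) * x)) = r * r ^ n" for n
      unfolding r_def exp_of_nat_mult[symmetric] exp_add[symmetric] by (simp add: algebra_simps)
    moreover have "r * (1 / (1 - r)) = 1 / (exp (2 * pi * x) - 1)"
      using r by (simp add: r_def exp_minus field_simps)
    ultimately show ?thesis
      using sums_mult[OF geometric_sums[OF r(1)], of r] by simp
  qed
  have int: "integrable lborel (f n)" for n
    using exp_sin_integral_0_infinity(1)[of "2 * pi * real (Suc n)" "2 * pi * y"]
    by (simp add: set_integrable_def f_def)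
  have val: "integral\<^sup>L lborel (f n) = y / ((real (Suc n))\<^sup>2 + y\<^sup>2) * (1 / (2 * pi))" for n
  proof -
    have "integral\<^sup>L lborel (f n) = 2 * pi * y / ((2 * pi * real (Suc n))\<^sup>2 + (2 * pi * y)\<^sup>2)"
      using exp_sin_integral_0_infinity(2)[of "2 * pi * real (Suc n)" "2 * pi * y"]
      by (simp add: set_lebesgue_integral_def f_def)
    also have "(2 * pi * real (Suc n))\<^sup>2 + (2 * pi * y)\<^sup>2 = 2 * pi * (((real (Suc n))\<^sup>2 + y\<^sup>2) * (2 * pi))"
      by algebra
    finally show ?thesis by simp
  qed
  have *: "(\<lambda>n. integral\<^sup>L lborel (f n)) sums (\<integral>x. (\<Sum>n. f n x) \<partial>lborel)"
  proof (rule sums_integral[OF int])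
    have "summable (\<lambda>n. norm (f n x))" for x
    proof (rule summable_comparison_test')
      show "summable (\<lambda>n. indicator {0<..} x *\<^sub>R exp (- (2 * pi * real (Suc n) * x)))"
        using geo[of x] by (auto simp: indicator_def sums_iff)
    qed (auto simp: f_def abs_mult indicator_def intro!: mult_left_le)
    then show "AE x in lborel. summable (\<lambda>n. norm (f n x))" by simp
    \<comment> \<open>Bounding the sine by 1 would give only a harmonic series of norms. The bound
      |sin t| <= t gains a factor x, hence terms of order 1 / n^2.\<close>
    have "summable (\<lambda>n. y / (2 * pi) * (1 / (real n + 1)\<^sup>2))"
      using inverse_squares_sums by (intro summable_mult) (simp add: sums_iff add.commute)
    then show "summable (\<lambda>n. \<integral>x. norm (f n x) \<partial>lborel)"
    proof (rule summable_comparison_test'[where N = 0])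
      fix n :: nat
      have pos: "2 * pi * real (Suc n) > 0" by simp
      note bi = has_bochner_integral_mult_right[OF times_exp_integral_0_infinity[OF pos], of "2 * pi * y"]
      have "(\<integral>x. norm (f n x) \<partial>lborel) \<le> 2 * pi * y * (1 / (2 * pi * real (Suc n))\<^sup>2)"
        unfolding has_bochner_integral_integral_eq[OF bi, symmetric]
      proof (rule integral_mono)
        show "norm (f n x) \<le> 2 * pi * y * (indicator {0<..} x *\<^sub>R (x * exp (- (2 * pi * real (Suc n) * x))))" for x
        proof (cases "x > 0")
          case True
          have "\<bar>sin (2 * pi * y * x)\<bar> \<le> 2 * pi * y * x"
            using abs_sin_x_le_abs_x[of "2 * pi * y * x"] True assms by simp
          then have "exp (- (2 * pi * real (Suc n) * x)) * \<bar>sin (2 * pi * y * x)\<bar>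
              \<le> exp (- (2 * pi * real (Suc n) * x)) * (2 * pi * y * x)"
            by (intro mult_left_mono) auto
          then show ?thesis using True by (simp add: f_def abs_mult mult_ac)
        qed (simp add: f_def)
      qed (use int bi in \<open>auto simp: has_bochner_integral_iff\<close>)
      also have "\<dots> = y / (2 * pi) * (1 / (real n + 1)\<^sup>2)"
        by (simp add: power_mult_distrib power2_eq_square[of pi] add.commute)
      finally show "norm (\<integral>x. norm (f n x) \<partial>lborel) \<le> y / (2 * pi) * (1 / (real n + 1)\<^sup>2)" by simp
    qed
  qed
  have "(\<lambda>n. f n x) sums (indicator {0<..} x *\<^sub>R (sin (2 * pi * x * y) / (exp (2 * pi * x) - 1)))" for x
    using sums_mult2[OF geo, of x "sin (2 * pi * x * y)"] by (cases "x > 0") (auto simp: f_def mult_ac)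
  then have "(\<integral>x. (\<Sum>n. f n x) \<partial>lborel) = (LINT x:{0<..}|lborel. sin (2 * pi * x * y) / (exp (2 * pi * x) - 1))"
    unfolding set_lebesgue_integral_def by (simp add: sums_iff)
  moreover have "(\<lambda>n. integral\<^sup>L lborel (f n)) sums
      ((pi / 2 + pi / (exp (2 * pi * y) - 1) - 1 / (2 * y)) * (1 / (2 * pi)))"
    unfolding val by (rule sums_mult2[OF coth_partial_fractions[OF assms]])
  moreover have "(pi / 2 + pi / (exp (2 * pi * y) - 1) - 1 / (2 * y)) * (1 / (2 * pi))
      = 1 / (2 * (exp (2 * pi * y) - 1)) + 1 / 4 - 1 / (4 * pi * y)"
  proof -
    have "(pi / 2 + pi / d - 1 / (2 * y)) * (1 / (2 * pi)) = 1 / (2 * d) + 1 / 4 - 1 / (4 * pi * y)" if "d \<noteq> 0" for d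
      using that assms by (simp add: field_simps)
    then show ?thesis using assms by simp
  qed
  ultimately show ?thesis
    using sums_unique2[OF *] by simp
qed

text \<open>With t = pi x, multiply 2 t <= 2 sinh t by exp t. The estimate controls the singularity
  at 0 and keeps exponential decay at infinity.\<close>

lemma bose_bound:
  fixes x :: real
  assumes "x > 0"
  shows "x / (exp (2 * pi * x) - 1) \<le> exp (- (pi * x)) / (2 * pi)"
proof -
  have "2 * (pi * x) \<le> exp (pi * x) - inverse (exp (pi * x))"
    using real_le_x_sinh[of "pi * x"] assms by simp
  from mult_right_mono[OF this, of "exp (pi * x)"]
  have "2 * pi * x * exp (pi * x) \<le> exp (pi * x) * exp (pi * x) - 1"
    by (simp add: left_diff_distrib)
  also have "exp (pi * x) * exp (pi * x) = exp (2 * pi * x)"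
    by (simp flip: exp_add)
  finally have "2 * pi * x * exp (pi * x) \<le> exp (2 * pi * x) - 1" .
  moreover have "exp (2 * pi * x) - 1 > 0" using assms by simp
  ultimately show ?thesis by (simp add: exp_minus field_simps)
qed

lemma integrable_bose:
  "set_integrable lborel {0<..} (\<lambda>x::real. x / (exp (2 * pi * x) - 1))"
proof (rule set_integrable_bound)
  show "set_integrable lborel {0<..} (\<lambda>x. 1 / (2 * pi) * exp (- (x * pi)))"
    using integrable_I0i_exp_mscale[of pi] by simp
  show "AE x in lborel. x \<in> {0<..} \<longrightarrow> norm (x / (exp (2 * pi * x) - 1)) \<le> norm (1 / (2 * pi) * exp (- (x * pi)))"
  proof (intro AE_I2 impI)
    fix x :: real assume "x \<in> {0<..}"
    then show "norm (x / (exp (2 * pi * x) - 1)) \<le> norm (1 / (2 * pi) * exp (- (x * pi)))"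
      using bose_bound[of x] by (simp add: mult.commute)
  qed
qed (simp add: set_borel_measurable_def)

subsection \<open>The transformation formula\<close>

lemma bose_le_1:
  fixes x :: real
  assumes "x > 0"
  shows "\<bar>x * (1 / (exp (2 * pi * x) - 1))\<bar> \<le> 1"
proof -
  have "x * 1 \<le> 2 * pi * x"
    using assms pi_ge_two by simp
  also have "\<dots> \<le> exp (2 * pi * x) - 1"
    using exp_ge_add_one_self[of "2 * pi * x"] by linarith
  finally show ?thesis using assms by simp
qed

text \<open>Evaluate the double integral of \<open>k x\<close> sin (2 pi x y) \<open>h y\<close> in
  both orders. Integrating in y first gives the sine side by \<open>gauss_sinh_sin_integral\<close>;
  integrating in x first gives, by \<open>sine_transform_bose\<close>, the sinh side together with
  the integrals of \<open>h y\<close> / 4 and \<open>h y\<close> / (4 pi y).\<close>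

lemma gauss_bose_transformation:
  fixes z :: complex
  assumes "p > 0" "q > 0" "p * q = pi"
  defines "k \<equiv> \<lambda>x. 1 / (exp (2 * pi * x) - 1)"
  shows "of_real (sqrt pi / (2 * q)) * exp (z\<^sup>2 / 4) *
      (LINT x:{0<..}|lborel. of_real (k x) * (of_real (exp (- (p * x)\<^sup>2)) * sin (of_real (p * x) * z)))
    = (LINT y:{0<..}|lborel. of_real (k y) * (of_real (exp (- (q * y)\<^sup>2)) * sinh (of_real (q * y) * z))) / 2
      + of_real (sqrt pi / (2 * q)) * exp (z\<^sup>2 / 4) * erf (z / 2) / 4 - erfi (z / 2) / 8"
proof -
  define h where "h = (\<lambda>y::real. of_real (exp (- (q * y)\<^sup>2)) * sinh (of_real (q * y) * z))"
  define f where "f = (\<lambda>x y. of_real (k x) * (of_real (sin (2 * pi * x * y)) * h y))"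
  have [measurable]: "h \<in> borel_measurable borel" "k \<in> borel_measurable borel"
    unfolding h_def k_def by measurable
  have "(LINT x:{0<..}|lborel. LINT y:{0<..}|lborel. f x y) = (LINT y:{0<..}|lborel. LINT x:{0<..}|lborel. f x y)"
  proof (rule Fubini_dominated)
    show "(\<lambda>(x, y). f x y) \<in> borel_measurable (lborel \<Otimes>\<^sub>M lborel)"
      unfolding f_def by measurable
    show "set_integrable lborel {0<..} (\<lambda>x. x * k x)"
      using integrable_bose by (simp add: k_def)
    \<comment> \<open>The bound |sin t| <= t supplies the x that tames \<open>k\<close> at 0. It
      also brings a factor y, as does the sinh; the resulting (q y)^2 is at most exp (2 q y), whence
      \<open>norm z + 2\<close> in the exponent.\<close>
    show "set_integrable lborel {0<..} (\<lambda>y. 2 * pi * norm z * exp (q * y * (norm z + 2) - (q * y)\<^sup>2) / q)"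
      using set_integrable_exp_gauss_real[OF assms(2)] by (intro set_integrable_divide set_integrable_mult_right)
    fix x y :: real assume "x \<in> {0<..}" "y \<in> {0<..}"
    then have xy: "x > 0" "y > 0" by auto
    have k: "k x \<ge> 0" using xy by (simp add: k_def)
    have "norm (h y) \<le> y * (q * norm z * exp (q * y * norm z - (q * y)\<^sup>2))"
      unfolding h_def by (rule cmod_gauss_sinh_le[OF assms(2) xy(2)])
    moreover have "\<bar>sin (2 * pi * x * y)\<bar> \<le> 2 * pi * x * y"
      using abs_sin_x_le_abs_x[of "2 * pi * x * y"] xy by simp
    ultimately have "k x * (\<bar>sin (2 * pi * x * y)\<bar> * norm (h y))
        \<le> k x * (2 * pi * x * y * (y * (q * norm z * exp (q * y * norm z - (q * y)\<^sup>2))))"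
      using k xy by (intro mult_left_mono mult_mono) auto
    also have "\<dots> = x * k x * (2 * pi * norm z * exp (q * y * norm z - (q * y)\<^sup>2) / q * (q * y)\<^sup>2)"
      using assms(2) by (simp add: power2_eq_square)
    also have "\<dots> \<le> x * k x * (2 * pi * norm z * exp (q * y * norm z - (q * y)\<^sup>2) / q * exp (q * y * 2))"
    proof -
      have "(q * y)\<^sup>2 \<le> (exp (q * y))\<^sup>2"
      proof (rule power_mono)
        show "q * y \<le> exp (q * y)"
          using exp_ge_add_one_self[of "q * y"] by linarith
      qed (use assms(2) xy in auto)
      also have "(exp (q * y))\<^sup>2 = exp (q * y * 2)"
        by (simp add: power2_eq_square flip: exp_add)
      finally show ?thesis
        using k xy assms(2) by (intro mult_left_mono) auto
    qed
    also have "\<dots> = x * k x * (2 * pi * norm z * exp (q * y * (norm z + 2) - (q * y)\<^sup>2) / q)"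
    proof -
      have "exp (q * y * norm z - (q * y)\<^sup>2) * exp (q * y * 2) = exp (q * y * (norm z + 2) - (q * y)\<^sup>2)"
        unfolding exp_add[symmetric] by (simp add: algebra_simps)
      then show ?thesis by simp
    qed
    finally show "norm (f x y) \<le> x * k x * (2 * pi * norm z * exp (q * y * (norm z + 2) - (q * y)\<^sup>2) / q)"
      using k by (simp add: f_def norm_mult)
  qed auto
  also have "(LINT x:{0<..}|lborel. LINT y:{0<..}|lborel. f x y) = of_real (sqrt pi / (2 * q)) * exp (z\<^sup>2 / 4) *
      (LINT x:{0<..}|lborel. of_real (k x) * (of_real (exp (- (p * x)\<^sup>2)) * sin (of_real (p * x) * z)))"
    unfolding f_def h_def set_integral_mult_right gauss_sinh_sin_integral[OF assms(1-3)]
    unfolding set_integral_mult_right[symmetric] by (simp only: mult_ac)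
  also have "(LINT y:{0<..}|lborel. LINT x:{0<..}|lborel. f x y)
      = (LINT y:{0<..}|lborel. of_real (k y) * h y / 2 + h y / 4 - of_real (1 / y) * h y / of_real (4 * pi))"
  proof (rule set_lebesgue_integral_cong)
    show "\<forall>y. y \<in> {0<..} \<longrightarrow> (LINT x:{0<..}|lborel. f x y)
      = of_real (k y) * h y / 2 + h y / 4 - of_real (1 / y) * h y / of_real (4 * pi)"
    proof (intro allI impI)
      fix y :: real assume y: "y \<in> {0<..}"
      have "f x y = of_real (sin (2 * pi * x * y) / (exp (2 * pi * x) - 1)) * h y" for x
        by (simp add: f_def k_def)
      then have "(LINT x:{0<..}|lborel. f x y) = of_real (k y / 2 + 1 / 4 - 1 / (4 * pi * y)) * h y"
        using sine_transform_bose[of y] y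
        by (simp only: set_integral_mult_left set_integral_complex_of_real) (simp add: k_def)
      then show "(LINT x:{0<..}|lborel. f x y)
        = of_real (k y) * h y / 2 + h y / 4 - of_real (1 / y) * h y / of_real (4 * pi)"
        by (simp add: ring_distribs mult_ac)
    qed
  qed auto
  also have "\<dots> = (LINT y:{0<..}|lborel. of_real (k y) * h y) / 2 + (LINT y:{0<..}|lborel. h y) / 4
      - (LINT y:{0<..}|lborel. of_real (1 / y) * h y) / of_real (4 * pi)"
  proof -
    have h: "set_integrable lborel {0<..} h"
      unfolding h_def by (rule set_integrable_gauss_sinh[OF assms(2)])
    have kh: "set_integrable lborel {0<..} (\<lambda>y. of_real (k y) * h y)"
      unfolding h_def using bose_le_1
      by (intro set_integrable_gauss_sinh_times[OF assms(2)]) (auto simp: k_def)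
    have h': "set_integrable lborel {0<..} (\<lambda>y. of_real (1 / y) * h y)"
      unfolding h_def by (intro set_integrable_gauss_sinh_times[OF assms(2)]) auto
    from h kh h' show ?thesis
      by (simp only: set_integral_add set_integral_diff set_integral_divide_zero set_integrable_divide)
  qed
  also have "(LINT y:{0<..}|lborel. h y) = of_real (sqrt pi / (2 * q)) * exp (z\<^sup>2 / 4) * erf (z / 2)"
    unfolding h_def by (rule gauss_sinh_integral[OF assms(2)])
  \<comment> \<open>Dividing this value by 4 pi produces the coefficient 1 / 8 of
    \<open>erfi\<close>.\<close>
  also have "(LINT y:{0<..}|lborel. of_real (1 / y) * h y) = of_real (pi / 2) * erfi (z / 2)"
    unfolding h_def by (rule gauss_sinh_over_integral[OF assms(2)])
  finally show ?thesis by (simp add: h_def)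
qed

text \<open>Under x -> - x the kernel changes by - 1 / (exp (- u) - 1) = 1 + 1 / (exp u - 1) with u
  = 2 pi x, the sign coming from oddness of \<open>g\<close>. The summand 1 leaves a pure Gaussian
  integral, which has a closed form.\<close>

lemma integral_bose_reflect:
  fixes g :: "real \<Rightarrow> complex"
  assumes odd: "\<And>x. g (- x) = - g x"
    and g: "set_integrable lborel {0<..} g"
      "set_integrable lborel {0<..} (\<lambda>x. of_real (1 / (exp (2 * pi * x) - 1)) * g x)"
  shows "(LBINT x=-\<infinity>..0. g x / of_real (exp (2 * pi * x) - 1))
    = (LINT x:{0<..}|lborel. g x) + (LINT x:{0<..}|lborel. of_real (1 / (exp (2 * pi * x) - 1)) * g x)"
proof -
  have "(LBINT x=-\<infinity>..0. g x / of_real (exp (2 * pi * x) - 1))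
      = (LINT x:{0<..}|lborel. g (- x) / of_real (exp (2 * pi * (- x)) - 1))"
    by (subst interval_integral_reflect) (simp add: interval_lebesgue_integral_0_infty)
  also have "\<dots> = (LINT x:{0<..}|lborel. g x + of_real (1 / (exp (2 * pi * x) - 1)) * g x)"
  proof (rule set_lebesgue_integral_cong)
    show "\<forall>x. x \<in> {0<..} \<longrightarrow> g (- x) / of_real (exp (2 * pi * (- x)) - 1)
        = g x + of_real (1 / (exp (2 * pi * x) - 1)) * g x"
    proof (intro allI impI)
      fix x :: real assume "x \<in> {0<..}"
      then have "exp (2 * pi * x) \<noteq> 1" by simp
      then have *: "- 1 / (exp (2 * pi * (- x)) - 1) = 1 + 1 / (exp (2 * pi * x) - 1)"
        by (simp add: exp_minus field_simps)
      have "g (- x) / of_real (exp (2 * pi * (- x)) - 1) = of_real (- 1 / (exp (2 * pi * (- x)) - 1)) * g x"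
        by (simp add: odd)
      then show "g (- x) / of_real (exp (2 * pi * (- x)) - 1)
        = g x + of_real (1 / (exp (2 * pi * x) - 1)) * g x"
        unfolding * of_real_add of_real_1 distrib_right mult_1 .
    qed
  qed auto
  finally show ?thesis using set_integral_add(2)[OF g] by simp
qed

theorem theorem1p2:
  fixes z :: complex and \<alpha> \<beta> :: real
  assumes "\<alpha> > 0" and "\<beta> > 0" and "\<alpha> * \<beta> = 1"
  shows "of_real (sqrt \<alpha>) * exp (z ^ 2 / 8) *
           (erf (z / 2) +
            4 * (LBINT x=-\<infinity>..0. of_real (exp (- pi * \<alpha> ^ 2 * x ^ 2)) * sin (of_real (sqrt pi * \<alpha> * x) * z)
                   / of_real (exp (2 * pi * x) - 1)))
       = of_real (sqrt \<beta>) * exp (- (z ^ 2 / 8)) *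
           (erfi (z / 2) +
            4 * (LBINT x=-\<infinity>..0. of_real (exp (- pi * \<beta> ^ 2 * x ^ 2)) * sinh (of_real (sqrt pi * \<beta> * x) * z)
                   / of_real (exp (2 * pi * x) - 1)))"
proof -
  define p q where "p = sqrt pi * \<alpha>" and "q = sqrt pi * \<beta>"
  have pq: "p > 0" "q > 0" "p * q = pi"
    using assms by (simp_all add: p_def q_def mult_ac)
  have exps: "- pi * \<alpha> ^ 2 * x ^ 2 = - (p * x)\<^sup>2" "- pi * \<beta> ^ 2 * x ^ 2 = - (q * x)\<^sup>2" for x
    by (simp_all add: p_def q_def power_mult_distrib)
  define k where "k = (\<lambda>x. 1 / (exp (2 * pi * x) - 1))"
  define g where "g = (\<lambda>x. of_real (exp (- (p * x)\<^sup>2)) * sin (of_real (p * x) * z))"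
  define h where "h = (\<lambda>x. of_real (exp (- (q * x)\<^sup>2)) * sinh (of_real (q * x) * z))"
  have [measurable]: "k \<in> borel_measurable borel"
    unfolding k_def by measurable
  have k_le: "\<bar>x * k x\<bar> \<le> 1" if "x > 0" for x
    unfolding k_def by (rule bose_le_1[OF that])
  have kh: "set_integrable lborel {0<..} (\<lambda>x. of_real (k x) * h x)"
    unfolding h_def using k_le by (intro set_integrable_gauss_sinh_times pq) auto
  have kg: "set_integrable lborel {0<..} (\<lambda>x. of_real (k x) * g x)"
  proof -
    have "of_real (k x) * g x = - \<i> * (of_real (k x) *
        (of_real (exp (- (p * x)\<^sup>2)) * sinh (of_real (p * x) * (\<i> * z))))" for x
      unfolding g_def sin_conv_sinh by (simp only: mult_ac)
    moreover have "set_integrable lborel {0<..} (\<lambda>x. of_real (k x) *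
        (of_real (exp (- (p * x)\<^sup>2)) * sinh (of_real (p * x) * (\<i> * z))))"
      using k_le by (intro set_integrable_gauss_sinh_times pq) auto
    ultimately show ?thesis by (simp only: set_integrable_mult_right)
  qed
  define I J where "I = (LINT x:{0<..}|lborel. of_real (k x) * g x)"
    and "J = (LINT x:{0<..}|lborel. of_real (k x) * h x)"
  define G where "G = exp (z\<^sup>2 / 8)"
  have G: "exp (z\<^sup>2 / 4) = G * G" "exp (- (z\<^sup>2 / 8)) = 1 / G" "exp (- (z\<^sup>2 / 4)) = 1 / (G * G)" "G \<noteq> 0"
    by (simp_all add: G_def exp_minus inverse_eq_divide flip: exp_add)
  \<comment> \<open>Square roots make the remaining identity polynomial: \<open>a * b = 1\<close>
    encodes the relation between \<open>\<alpha>\<close> and \<open>\<beta>\<close>.\<close>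
  define a b where "a = complex_of_real (sqrt \<alpha>)" and "b = complex_of_real (sqrt \<beta>)"
  have ab: "a * b = 1" "of_real \<alpha> = a * a" "of_real \<beta> = b * b"
    using assms by (simp_all add: a_def b_def flip: of_real_mult real_sqrt_mult)
  \<comment> \<open>Here 1 / (2 \<open>\<alpha>\<close>) = \<open>\<beta>\<close> / 2 and
    conversely, so each coefficient involves the opposite parameter.\<close>
  have coeffs: "complex_of_real (sqrt pi / (2 * p)) = b * b / 2" "complex_of_real (sqrt pi / (2 * q)) = a * a / 2"
  proof -
    have "sqrt pi / (2 * p) = \<beta> / 2" "sqrt pi / (2 * q) = \<alpha> / 2"
      using assms by (simp_all add: p_def q_def field_simps)
    then show "complex_of_real (sqrt pi / (2 * p)) = b * b / 2" "complex_of_real (sqrt pi / (2 * q)) = a * a / 2"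
      by (simp_all only: of_real_divide ab(2,3) of_real_numeral)
  qed
  have left: "(LBINT x=-\<infinity>..0. g x / of_real (exp (2 * pi * x) - 1)) = b * b / 2 * (1 / (G * G)) * erfi (z / 2) + I"
  proof -
    have "set_integrable lborel {0<..} g" "(LINT x:{0<..}|lborel. g x) = b * b / 2 * (1 / (G * G)) * erfi (z / 2)"
      using set_integrable_gauss_sin[OF pq(1), of z] gauss_sin_integral[OF pq(1), of z]
      unfolding g_def coeffs G by auto
    moreover have "g (- x) = - g x" for x
      by (simp add: g_def)
    ultimately show ?thesis
      using integral_bose_reflect[of g] kg by (simp add: k_def I_def)
  qed
  have right: "(LBINT x=-\<infinity>..0. h x / of_real (exp (2 * pi * x) - 1)) = a * a / 2 * (G * G) * erf (z / 2) + J"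
  proof -
    have "set_integrable lborel {0<..} h" "(LINT x:{0<..}|lborel. h x) = a * a / 2 * (G * G) * erf (z / 2)"
      using set_integrable_gauss_sinh[OF pq(2), of z] gauss_sinh_integral[OF pq(2), of z]
      unfolding h_def coeffs G by auto
    moreover have "h (- x) = - h x" for x
      by (simp add: h_def)
    ultimately show ?thesis
      using integral_bose_reflect[of h] kh by (simp add: k_def J_def)
  qed
  have main: "a * a / 2 * (G * G) * I = J / 2 + a * a / 2 * (G * G) * erf (z / 2) / 4 - erfi (z / 2) / 8"
    using gauss_bose_transformation[OF pq, of z]
    unfolding coeffs G I_def J_def g_def h_def k_def .
  \<comment> \<open>Pure algebra, with \<open>e\<close> and \<open>f\<close> standing for the values
    of \<open>erf\<close> and \<open>erfi\<close>. Eliminating \<open>I\<close> turns either side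
    into a combination of \<open>e\<close>, \<open>f\<close> and \<open>J\<close>.\<close>
  have "a * G * (e + 4 * (b * b / 2 * (1 / (G * G)) * f + I)) = b * (1 / G) * (f + 4 * (a * a / 2 * (G * G) * e + J))"
    if "a * a / 2 * (G * G) * I = J / 2 + a * a / 2 * (G * G) * e / 4 - f / 8" for e f
  proof -
    define r where "r = 1 / G"
    have r: "G * r = 1" "1 / (G * G) = r * r" using G(4) by (simp_all add: r_def)
    \<comment> \<open>Multiplying the transformation formula by 8 \<open>b\<close> /
      \<open>G\<close> isolates the term 4 \<open>a\<close> \<open>G\<close> \<open>I\<close> of the
      left side, up to the unit factors \<open>a * b\<close> and \<open>G * r\<close>.\<close>
    have "(a * b) * (G * r) * (4 * (a * G * I)) = 8 * b * r * (a * a / 2 * (G * G) * I)"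
      by algebra
    also have "\<dots> = 4 * (b * r * J) + (a * b) * (G * r) * (a * G * e) - b * r * f"
      unfolding that by (simp add: algebra_simps)
    finally have I: "4 * (a * G * I) = 4 * (b * r * J) + a * G * e - b * r * f"
      by (simp only: r(1) ab(1) mult_1)
    have "a * G * (e + 4 * (b * b / 2 * (r * r) * f + I))
        = a * G * e + 2 * ((a * b) * (G * r)) * (b * r * f) + 4 * (a * G * I)"
      by algebra
    also have "\<dots> = b * r * f + 2 * ((a * b) * (G * r)) * (a * G * e) + 4 * (b * r * J)"
      unfolding I r(1) ab(1) by algebra
    also have "\<dots> = b * r * (f + 4 * (a * a / 2 * (G * G) * e + J))"
      by algebra
    finally show ?thesis
      unfolding r(2) r_def[symmetric] .
  qed
  from this[OF main] show ?thesis
    unfolding exps p_def[symmetric] q_def[symmetric]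
    using left right unfolding g_def h_def a_def b_def G_def[symmetric] G by simp
qed

end
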